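(* Let $X,Y$ be real Banach spaces, let $\Phi,\Psi:B_X\to Y$ be norm one functions, let $\Gamma\subset B_X$ be a norm determining set for $\Phi$, let $\Delta\subset S_Y$, and let $\mathcal{W}\subset\ell_\infty(B_X)$ be a set of functions of norm at most $1$. Suppose that $Y$ has the $\Phi$-Daugavet property with respect to $(\Gamma,\mathcal{W},\Delta)$, and that for all $\varepsilon>0$ there are $x'\in\mathcal{W}$, $\delta>0$ and $y\in\Delta$ such that for all $\omega\in\mathbb{T}$ $$\Psi(S(\omega x',\delta)\cap\Gamma)\subset B_\varepsilon(\overline{\omega}y).$$ Then $$\|\Phi+\Psi\|_\Gamma=2.$$
   Context: All spaces are real, so $\mathbb{T}=\{1,-1\}$ (and $\overline{\omega}=\omega$). $B_X$ is the closed unit ball of $X$, $S_Y$ the unit sphere of $Y$, and $B_\varepsilon(u)$ the ball of radius $\varepsilon$ centred at $u$. $\ell_\infty(B_X,Y)$ is the space of all bounded (not necessarily linear or continuous) maps $B_X\to Y$ with the sup norm $\|\Phi\|=\sup_{x\in B_X}\|\Phi(x)\|$; $\ell_\infty(B_X)=\ell_\infty(B_X,\mathbb{R})$. A norm one function is one of sup norm $1$. For $\Gamma\subset B_X$, $\|\Psi\|_\Gamma=\sup_{x\in\Gamma}\|\Psi(x)\|$, and $\Gamma$ is norm determining for $\Phi$ if $\|\Phi\|=\|\Phi\|_\Gamma$. For a function $p:B_X\to\mathbb{R}$ with $\|p\|\le1$ and $\varepsilon>0$, $S(p,\varepsilon)=\{x\in B_X:p(x)\ge1-\varepsilon\}$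 (possibly empty). $Y$ has the $\Phi$-Daugavet property with respect to $(\Gamma,\mathcal{W},\Delta)$ if for every $x'\in\mathcal{W}$ and $y\in\Delta$, $\sup_{x\in\Gamma}\|\Phi(x)+x'(x)y\|=2$. *)

theory Defs
  imports "HOL-Analysis.Analysis"
begin

(* Maps on the closed unit ball are represented by total functions; only their values on
   cball 0 1 are ever used. *)

definition ell_infty :: "('a::real_normed_vector \<Rightarrow> 'b::real_normed_vector) set" where
  "ell_infty = {f. bounded (f ` cball 0 1)}"

(* The supremum over the empty set is 0: it is taken in the interval from 0 to infinity,
   whereas Sup of the empty set of reals is unspecified in HOL. *)
definition sup_norm_on ::
    "'a::real_normed_vector set \<Rightarrow> ('a \<Rightarrow> 'b::real_normed_vector) \<Rightarrow> real" where
  "sup_norm_on \<Gamma> f = (if \<Gamma> = {} then 0 else (SUP x\<in>\<Gamma>. norm (f x)))"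

definition sup_norm :: "('a::real_normed_vector \<Rightarrow> 'b::real_normed_vector) \<Rightarrow> real" where
  "sup_norm f = sup_norm_on (cball 0 1) f"

definition norm_one :: "('a::real_normed_vector \<Rightarrow> 'b::real_normed_vector) \<Rightarrow> bool" where
  "norm_one f \<longleftrightarrow> f \<in> ell_infty \<and> sup_norm f = 1"

definition norm_determining ::
    "'a::real_normed_vector set \<Rightarrow> ('a \<Rightarrow> 'b::real_normed_vector) \<Rightarrow> bool" where
  "norm_determining \<Gamma> f \<longleftrightarrow> sup_norm f = sup_norm_on \<Gamma> f"

definition slice :: "('a::real_normed_vector \<Rightarrow> real) \<Rightarrow> real \<Rightarrow> 'a set" where
  "slice p \<epsilon> = {x \<in> cball 0 1. p x \<ge> 1 - \<epsilon>}"

definition daugavet_property ::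
    "('a::real_normed_vector \<Rightarrow> 'b::real_normed_vector) \<Rightarrow> 'a set \<Rightarrow> ('a \<Rightarrow> real) set \<Rightarrow> 'b set \<Rightarrow> bool"
  where
  "daugavet_property \<Phi> \<Gamma> \<W> \<Delta> \<longleftrightarrow>
     (\<forall>x'\<in>\<W>. \<forall>y\<in>\<Delta>. sup_norm_on \<Gamma> (\<lambda>x. \<Phi> x + x' x *\<^sub>R y) = 2)"

end

theory Submission
  imports Defs
begin

text \<open>
  By the Daugavet property choose \<open>x \<in> \<Gamma>\<close> at which \<open>\<Phi> x + x' x *\<^sub>R y\<close> almost has norm \<open>2\<close>.
  This forces \<open>\<bar>x' x\<bar>\<close> to be almost \<open>1\<close>, so with \<open>\<omega>\<close> the sign of \<open>x' x\<close> the point \<open>x\<close> lies in the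
  slice of \<open>\<omega> x'\<close>. There \<open>\<Psi> x\<close> is close to \<open>\<omega> *\<^sub>R y\<close>, hence to \<open>x' x *\<^sub>R y\<close>, and so
  \<open>\<Phi> x + \<Psi> x\<close> almost has norm \<open>2\<close> as well.
\<close>

lemma norm_le_sup_norm:
  assumes "f \<in> ell_infty" and "x \<in> cball 0 1"
  shows "norm (f x) \<le> sup_norm f"
proof -
  obtain b where "\<forall>z\<in>f ` cball 0 1. norm z \<le> b"
    using assms(1) by (auto simp: ell_infty_def bounded_iff)
  then have "bdd_above ((\<lambda>x. norm (f x)) ` cball 0 1)"
    by (intro bdd_aboveI2[where M = b]) auto
  then have "norm (f x) \<le> (SUP x\<in>cball 0 1. norm (f x))"
    using assms(2) by (rule cSUP_upper[rotated])
  then show ?thesis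
    using assms(2) by (auto simp: sup_norm_def sup_norm_on_def)
qed

text \<open>If no value exceeded \<open>r\<close>, then \<open>r\<close> would bound the supremum.
  The assumption \<open>0 \<le> r\<close> covers empty \<Gamma>, where \<open>sup_norm_on\<close> is
  0 by convention.\<close>

lemma less_sup_norm_onD:
  assumes "r < sup_norm_on \<Gamma> f" and "0 \<le> r"
  shows "\<exists>x\<in>\<Gamma>. r < norm (f x)"
proof (rule ccontr)
  assume "\<not> ?thesis"
  then have "sup_norm_on \<Gamma> f \<le> r"
    using assms(2) unfolding sup_norm_on_def
    by (auto intro!: cSUP_least simp: not_less)
  with assms(1) show False by simp
qed

text \<open>Besides bounding the supremum by \<open>c\<close>, \<open>le\<close> provides the
  \<open>bdd_above\<close> fact that makes each value a lower bound for it.\<close>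

lemma sup_norm_on_eqI:
  assumes "\<Gamma> \<noteq> {}" and le: "\<And>x. x \<in> \<Gamma> \<Longrightarrow> norm (f x) \<le> c"
    and ge: "\<And>\<epsilon>. 0 < \<epsilon> \<Longrightarrow> \<exists>x\<in>\<Gamma>. c - \<epsilon> \<le> norm (f x)"
  shows "sup_norm_on \<Gamma> f = c"
proof -
  have bdd: "bdd_above ((\<lambda>x. norm (f x)) ` \<Gamma>)"
    using le by (rule bdd_aboveI2)
  have "(SUP x\<in>\<Gamma>. norm (f x)) = c"
  proof (rule antisym)
    show "(SUP x\<in>\<Gamma>. norm (f x)) \<le> c"
      using assms(1) le by (rule cSUP_least)
    show "c \<le> (SUP x\<in>\<Gamma>. norm (f x))"
    proof (rule field_le_epsilon)
      fix \<epsilon> :: real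
      assume "0 < \<epsilon>"
      then obtain x where "x \<in> \<Gamma>" and "c - \<epsilon> \<le> norm (f x)"
        using ge by blast
      moreover have "norm (f x) \<le> (SUP x\<in>\<Gamma>. norm (f x))"
        using bdd \<open>x \<in> \<Gamma>\<close> by (rule cSUP_upper[rotated])
      ultimately show "c \<le> (SUP x\<in>\<Gamma>. norm (f x)) + \<epsilon>" by linarith
    qed
  qed
  then show ?thesis using assms(1) by (simp add: sup_norm_on_def)
qed

theorem theorem5p7:
  fixes \<Phi> \<Psi> :: "'a::banach \<Rightarrow> 'b::banach"
    and \<Gamma> :: "'a set" and \<Delta> :: "'b set" and \<W> :: "('a \<Rightarrow> real) set"
  assumes "norm_one \<Phi>" and "norm_one \<Psi>"
    and "\<Gamma> \<subseteq> cball 0 1" and "norm_determining \<Gamma> \<Phi>"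
    and "\<Delta> \<subseteq> sphere 0 1"
    and "\<W> \<subseteq> {p \<in> ell_infty. sup_norm p \<le> 1}"
    and "daugavet_property \<Phi> \<Gamma> \<W> \<Delta>"
    and "\<forall>\<epsilon>>0. \<exists>x'\<in>\<W>. \<exists>\<delta>>0. \<exists>y\<in>\<Delta>. \<forall>\<omega>\<in>{1, - 1 :: real}.
           \<Psi> ` (slice (\<lambda>x. \<omega> * x' x) \<delta> \<inter> \<Gamma>) \<subseteq> cball (\<omega> *\<^sub>R y) \<epsilon>"
  shows "sup_norm_on \<Gamma> (\<lambda>x. \<Phi> x + \<Psi> x) = 2"
proof (rule sup_norm_on_eqI)
  have \<Phi>_le: "norm (\<Phi> x) \<le> 1" and \<Psi>_le: "norm (\<Psi> x) \<le> 1" if "x \<in> \<Gamma>" for x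
    using norm_le_sup_norm[of \<Phi> x] norm_le_sup_norm[of \<Psi> x] assms(1-3) that
    by (auto simp: norm_one_def)
  \<comment> \<open>On an empty set \<open>sup_norm_on\<close> is 0, but a norm determining set must
    give \<Phi> the value 1.\<close>
  show "\<Gamma> \<noteq> {}"
    using assms(1,4) by (auto simp: norm_one_def norm_determining_def sup_norm_on_def)
  show "norm (\<Phi> x + \<Psi> x) \<le> 2" if "x \<in> \<Gamma>" for x
    using norm_triangle_ineq[of "\<Phi> x" "\<Psi> x"] \<Phi>_le[OF that] \<Psi>_le[OF that] by linarith
  fix \<epsilon> :: real
  assume "0 < \<epsilon>"
  \<comment> \<open>One third of \<epsilon> pays for replacing \<open>\<Psi> x\<close> by
    \<open>\<omega> *\<^sub>R y\<close>; the other two will be bounded by \<eta>.\<close>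
  then obtain x' \<delta> y where "x' \<in> \<W>" "\<delta> > 0" "y \<in> \<Delta>"
    and image: "\<And>\<omega>. \<omega> \<in> {1, - 1 :: real} \<Longrightarrow>
      \<Psi> ` (slice (\<lambda>x. \<omega> * x' x) \<delta> \<inter> \<Gamma>) \<subseteq> cball (\<omega> *\<^sub>R y) (\<epsilon> / 3)"
    using assms(8)[THEN spec, of "\<epsilon> / 3"] by (meson divide_pos_pos zero_less_numeral)
  \<comment> \<open>The bound 1 keeps \<open>2 - \<eta>\<close> nonnegative for
    \<open>less_sup_norm_onD\<close>, \<delta> puts \<open>x\<close> into the slice, and
    \<open>\<epsilon> / 3\<close> serves the final estimate, where \<eta> enters twice.\<close>
  define \<eta> where "\<eta> = min 1 (min \<delta> (\<epsilon> / 3))"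
  have \<eta>: "0 < \<eta>" "\<eta> \<le> 1" "\<eta> \<le> \<delta>" "\<eta> \<le> \<epsilon> / 3"
    using \<open>0 < \<epsilon>\<close> \<open>\<delta> > 0\<close> by (auto simp: \<eta>_def)
  have "sup_norm_on \<Gamma> (\<lambda>x. \<Phi> x + x' x *\<^sub>R y) = 2"
    using assms(7) \<open>x' \<in> \<W>\<close> \<open>y \<in> \<Delta>\<close> by (simp add: daugavet_property_def)
  then obtain x where "x \<in> \<Gamma>" and x: "2 - \<eta> < norm (\<Phi> x + x' x *\<^sub>R y)"
    using less_sup_norm_onD[of "2 - \<eta>" \<Gamma> "\<lambda>x. \<Phi> x + x' x *\<^sub>R y"] \<eta> by auto
  have "norm y = 1"
    using assms(5) \<open>y \<in> \<Delta>\<close> by auto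
  have "x \<in> cball 0 1"
    using assms(3) \<open>x \<in> \<Gamma>\<close> by blast
  then have x'_le: "\<bar>x' x\<bar> \<le> 1"
    using norm_le_sup_norm[of x' x] assms(6) \<open>x' \<in> \<W>\<close> by fastforce
  have "norm (\<Phi> x + x' x *\<^sub>R y) \<le> norm (\<Phi> x) + \<bar>x' x\<bar>"
    using norm_triangle_ineq[of "\<Phi> x" "x' x *\<^sub>R y"] \<open>norm y = 1\<close> by simp
  \<comment> \<open>As \<open>\<Phi> x\<close> contributes at most 1 to a norm above
    \<open>2 - \<eta>\<close>, the rest must come from \<open>x' x\<close>.\<close>
  then have x'_ge: "1 - \<eta> \<le> \<bar>x' x\<bar>"
    using x \<Phi>_le[OF \<open>x \<in> \<Gamma>\<close>] by linarith
  define \<omega> :: real where "\<omega> = (if 0 \<le> x' x then 1 else - 1)"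
  \<comment> \<open>The last equation holds because \<open>x' x\<close> lies in [-1, 1] on the same
    side of 0 as \<omega>.\<close>
  have \<omega>: "\<omega> \<in> {1, - 1}" "\<omega> * x' x = \<bar>x' x\<bar>" "\<bar>x' x - \<omega>\<bar> = 1 - \<bar>x' x\<bar>"
    using x'_le by (auto simp: \<omega>_def)
  have "x \<in> slice (\<lambda>x. \<omega> * x' x) \<delta>"
    using \<open>x \<in> cball 0 1\<close> x'_ge \<eta>(3) \<omega>(2) by (simp add: slice_def)
  then have "norm (\<omega> *\<^sub>R y - \<Psi> x) \<le> \<epsilon> / 3"
    using image[OF \<omega>(1)] \<open>x \<in> \<Gamma>\<close> by (auto simp: dist_norm)
  moreover have "norm (x' x *\<^sub>R y - \<omega> *\<^sub>R y) \<le> \<eta>"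
    using \<open>norm y = 1\<close> \<omega>(3) x'_ge by (simp flip: scaleR_diff_left)
  \<comment> \<open>The vector on the left is the sum of the three on the right: the terms
    \<open>\<Psi> x\<close> and \<open>\<omega> *\<^sub>R y\<close> cancel.\<close>
  moreover have "norm (\<Phi> x + x' x *\<^sub>R y)
      \<le> norm (\<Phi> x + \<Psi> x) + norm (x' x *\<^sub>R y - \<omega> *\<^sub>R y) + norm (\<omega> *\<^sub>R y - \<Psi> x)"
    using norm_triangle_ineq[of "\<Phi> x + \<Psi> x + (x' x *\<^sub>R y - \<omega> *\<^sub>R y)" "\<omega> *\<^sub>R y - \<Psi> x"]
      norm_triangle_ineq[of "\<Phi> x + \<Psi> x" "x' x *\<^sub>R y - \<omega> *\<^sub>R y"]
    by (simp add: algebra_simps)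
  ultimately have "2 - \<epsilon> \<le> norm (\<Phi> x + \<Psi> x)"
    using x \<eta>(4) by linarith
  then show "\<exists>x\<in>\<Gamma>. 2 - \<epsilon> \<le> norm (\<Phi> x + \<Psi> x)"
    using \<open>x \<in> \<Gamma>\<close> by blast
qed

end
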